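(* Let $n\ge 2$, let $\alpha_1,\dots,\alpha_n>0$ be pairwise distinct, let $c>0$, let $X_1,\dots,X_n$ be independent with $X_i\sim \mathrm{Exp}(\alpha_i)$, and set $k=\frac1c$, $\lambda_i=\frac{1}{\alpha_i^{c}}$ and $Y_i=X_i^{c}$. Then $Y_i\sim \mathrm{Weibull}(k,\lambda_i)$ for each $i$, and the Mixed Hypoexponential Weibull distribution $Z\sim MHW(k,\lambda_1,\dots,\lambda_n)$, i.e. the mixed T-G distribution generated from the hypoexponential distribution with parameters $(\alpha_1,\dots,\alpha_n)$ and the transformation $x\mapsto x^{c}$, has PDF $$f_Z(t)=\sum_{i=1}^n\frac{1}{PW_i}f_{Y_i}(t),\qquad PW_i=\prod_{j=1,\,j\ne i}^{n}\left(1-\left(\frac{\lambda_j}{\lambda_i}\right)^{k}\right).$$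
   Context: $\mathrm{Exp}(\alpha)$ has density $\alpha e^{-\alpha t}$ for $t>0$. The hypoexponential distribution with pairwise distinct parameters $\alpha_1,\dots,\alpha_n>0$ is the law of $S_n=\sum_{i=1}^nX_i$ with $X_i\sim\mathrm{Exp}(\alpha_i)$ independent; its density is $f_{S_n}(t)=\sum_{i=1}^n\frac{f_{X_i}(t)}{P_i}$, $t>0$, where $P_i=\prod_{j\ne i}\left(1-\frac{\alpha_i}{\alpha_j}\right)$ (known fact). If a distribution $T$ has density $\sum_iA_if_{X_i}$ with $A_i\in\mathbb{R}$, $\sum_iA_i=1$, and $g$ is a one-to-one function, the mixed T-G distribution generated from $T$ and $g$ is the distribution with density $\sum_iA_if_{g(X_i)}$. $\mathrm{Weibull}(k,\lambda)$ with shape $k>0$ and scale $\lambda>0$ has density $\frac{k}{\lambda}\left(\frac{t}{\lambda}\right)^{k-1}e^{-(t/\lambda)^{k}}$ for $t>0$. *)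

theory Defs
  imports "HOL-Probability.Probability"
begin

text \<open>Real-valued densities. Linear combinations with coefficients of either sign occur below, and
  \<^term>\<open>ennreal\<close> truncates negative values to 0, so nonnegativity is part of the notion; it is only
  required almost everywhere because densities are determined only up to null sets.\<close>

definition has_pdf :: "real measure \<Rightarrow> (real \<Rightarrow> real) \<Rightarrow> bool" where
  "has_pdf D f \<longleftrightarrow>
     prob_space D \<and> f \<in> borel_measurable lborel \<and> (AE t in lborel. 0 \<le> f t) \<and>
     D = density lborel (\<lambda>t. ennreal (f t))"

definition weibull_density :: "real \<Rightarrow> real \<Rightarrow> real \<Rightarrow> real" where
  "weibull_density k l t =
     (if 0 < t then k / l * (t / l) powr (k - 1) * exp (- ((t / l) powr k)) else 0)"

definition exponential_law :: "real \<Rightarrow> real measure" where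
  "exponential_law a = density lborel (\<lambda>t. ennreal (exponential_density a t))"

definition hypoexponential_law :: "'i set \<Rightarrow> ('i \<Rightarrow> real) \<Rightarrow> real measure" where
  "hypoexponential_law I \<alpha> =
     distr (\<Pi>\<^sub>M i\<in>I. exponential_law (\<alpha> i)) borel (\<lambda>x. \<Sum>i\<in>I. x i)"

text \<open>\<open>mixed_TG I F T S g D\<close>: the distribution \<open>D\<close> is a mixed T-G distribution generated from the
  distribution \<open>T\<close> and the function \<open>g\<close>, where \<open>F i\<close> is the law of \<open>X\<^sub>i\<close>, so that
  \<open>distr (F i) borel g\<close> is the law of \<open>g (X\<^sub>i)\<close>. The function \<open>g\<close> need only be one-to-one on
  a set \<open>S\<close> that carries all the \<open>X\<^sub>i\<close>.\<close>

definition mixed_TG ::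
  "'i set \<Rightarrow> ('i \<Rightarrow> real measure) \<Rightarrow> real measure \<Rightarrow> real set \<Rightarrow> (real \<Rightarrow> real) \<Rightarrow> real measure \<Rightarrow> bool"
where
  "mixed_TG I F T S g D \<longleftrightarrow>
     g \<in> borel_measurable borel \<and> inj_on g S \<and> (\<forall>i\<in>I. AE x in F i. x \<in> S) \<and>
     (\<exists>A f h.
        (\<Sum>i\<in>I. A i) = 1 \<and>
        (\<forall>i\<in>I. has_pdf (F i) (f i) \<and> has_pdf (distr (F i) borel g) (h i)) \<and>
        has_pdf T (\<lambda>t. \<Sum>i\<in>I. A i * f i t) \<and>
        has_pdf D (\<lambda>t. \<Sum>i\<in>I. A i * h i t))"

end

theory Submission
  imports Defs "HOL-Real_Asymp.Real_Asymp"
begin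

text \<open>Convolving one exponential law at a time, and using the partial fraction expansion of
  \<open>\<Prod>\<^sub>j \<alpha>\<^sub>j / (\<alpha>\<^sub>j - z)\<close> to identify the new coefficient, gives the density
  \<open>\<Sum>\<^sub>i f\<^bsub>X\<^sub>i\<^esub> / P\<^sub>i\<close> of the hypoexponential law. Exponentials with distinct rates are linearly
  independent, so these are the only weights that a representation of that density can have, and
  \<open>(\<lambda>\<^sub>j / \<lambda>\<^sub>i)\<^sup>k = \<alpha>\<^sub>i / \<alpha>\<^sub>j\<close> turns \<open>P\<^sub>i\<close> into \<open>PW\<^sub>i\<close>. The mixture of Weibull densities is nonnegative
  because each Weibull density at \<open>t\<close> is the exponential density at \<open>t\<^sup>k\<close> times the common factor
  \<open>k t\<^bsup>k-1\<^esup>\<close>.\<close>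

subsection \<open>Partial fractions\<close>

text \<open>This is \<open>1 / P_i\<close>. For distinct nonzero parameters it is the coefficient of
  \<alpha>_i / (\<alpha>_i - z) in the partial fraction expansion of the product of all \<alpha>_j /
  (\<alpha>_j - z).\<close>

definition hypoexp_coeff :: "'i set \<Rightarrow> ('i \<Rightarrow> real) \<Rightarrow> 'i \<Rightarrow> real" where
  "hypoexp_coeff I \<alpha> i = 1 / (\<Prod>j\<in>I - {i}. 1 - \<alpha> i / \<alpha> j)"

definition hypoexp_density :: "'i set \<Rightarrow> ('i \<Rightarrow> real) \<Rightarrow> real \<Rightarrow> real" where
  "hypoexp_density I \<alpha> t = (\<Sum>i\<in>I. hypoexp_coeff I \<alpha> i * exponential_density (\<alpha> i) t)"

lemma hypoexp_coeff_insert_old: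
  assumes "finite I" "a \<notin> I" "i \<in> I" "\<alpha> a \<noteq> 0" "\<alpha> i \<noteq> \<alpha> a"
  shows "hypoexp_coeff (insert a I) \<alpha> i = hypoexp_coeff I \<alpha> i * (\<alpha> a / (\<alpha> a - \<alpha> i))"
proof -
  have "insert a I - {i} = insert a (I - {i})"
    using assms by auto
  moreover have "1 - \<alpha> i / \<alpha> a = (\<alpha> a - \<alpha> i) / \<alpha> a"
    using assms by (simp add: field_simps)
  ultimately show ?thesis
    using assms by (simp add: hypoexp_coeff_def)
qed

text \<open>The right-hand side is the product over the old indices evaluated at z =
  \<open>\<alpha> a\<close>, so a partial fraction expansion at that point rewrites the new
  coefficient.\<close>

lemma hypoexp_coeff_insert_self:
  assumes "a \<notin> I" "\<And>i. i \<in> I \<Longrightarrow> \<alpha> i \<noteq> 0" "\<alpha> a \<notin> \<alpha> ` I"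
  shows "hypoexp_coeff (insert a I) \<alpha> a = (\<Prod>j\<in>I. \<alpha> j / (\<alpha> j - \<alpha> a))"
proof -
  have "hypoexp_coeff (insert a I) \<alpha> a = (\<Prod>j\<in>I. 1 / (1 - \<alpha> a / \<alpha> j))"
    using assms(1) by (simp add: hypoexp_coeff_def prod_dividef)
  also have "\<dots> = (\<Prod>j\<in>I. \<alpha> j / (\<alpha> j - \<alpha> a))"
    using assms(2,3) by (intro prod.cong) (auto simp: field_simps)
  finally show ?thesis .
qed

text \<open>Induction on the index set: multiplying by the new factor splits each old fraction into
  a part with its own pole and a part with pole \<open>\<alpha> a\<close>. The latter parts add up
  to the new coefficient by the induction hypothesis at \<open>\<alpha> a\<close>, which is why z is
  generalized.\<close>

lemma partial_fractions_prod_linear: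
  assumes "finite I" "I \<noteq> {}" "inj_on \<alpha> I" "\<And>i. i \<in> I \<Longrightarrow> \<alpha> i \<noteq> 0" "z \<notin> \<alpha> ` I"
  shows "(\<Prod>j\<in>I. \<alpha> j / (\<alpha> j - z)) = (\<Sum>i\<in>I. hypoexp_coeff I \<alpha> i * (\<alpha> i / (\<alpha> i - z)))"
  using assms
proof (induction I arbitrary: z rule: finite_ne_induct)
  case (singleton x)
  then show ?case by (simp add: hypoexp_coeff_def)
next
  case (insert a I)
  have neq: "\<alpha> i \<noteq> \<alpha> a" if "i \<in> I" for i
    using insert.prems(1) insert.hyps(3) that by (metis inj_onD insertI1 insertI2)
  have nz: "\<alpha> a \<noteq> 0" "\<alpha> a \<noteq> z" "\<And>i. i \<in> I \<Longrightarrow> \<alpha> i \<noteq> z"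
    using insert.prems by auto
  have IH: "(\<Prod>j\<in>I. \<alpha> j / (\<alpha> j - w)) = (\<Sum>i\<in>I. hypoexp_coeff I \<alpha> i * (\<alpha> i / (\<alpha> i - w)))"
    if "w \<notin> \<alpha> ` I" for w
    using insert.IH insert.prems that by (auto simp: inj_on_insert)
  have notin: "\<alpha> a \<notin> \<alpha> ` I" using neq by (metis imageE)
  have coeff_a: "hypoexp_coeff (insert a I) \<alpha> a =
      (\<Sum>i\<in>I. hypoexp_coeff I \<alpha> i * (\<alpha> i / (\<alpha> i - \<alpha> a)))"
    using IH[OF notin] hypoexp_coeff_insert_self[of a I \<alpha>] insert.hyps(3) insert.prems(2) notin by simp
  have coeff_i: "hypoexp_coeff (insert a I) \<alpha> i = hypoexp_coeff I \<alpha> i * (\<alpha> a / (\<alpha> a - \<alpha> i))"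
    if "i \<in> I" for i
    using hypoexp_coeff_insert_old[of I a i \<alpha>] insert.hyps neq nz that by auto
  \<comment> \<open>Two-pole partial fractions of the product of b / (b - z) and the new factor,
    with a spectator weight h.\<close>
  have summand: "h * (b / (b - \<alpha> a)) * (\<alpha> a / (\<alpha> a - z)) + h * (\<alpha> a / (\<alpha> a - b)) * (b / (b - z))
      = h * (b / (b - z)) * (\<alpha> a / (\<alpha> a - z))"
    if "b \<noteq> \<alpha> a" "b \<noteq> z" for h b
  proof -
    have *: "b - \<alpha> a \<noteq> 0" "\<alpha> a - b \<noteq> 0" "b - z \<noteq> 0" "\<alpha> a - z \<noteq> 0" using that nz by auto
    have **: "\<alpha> a / (\<alpha> a - b) = - (\<alpha> a / (b - \<alpha> a))"
      by (metis minus_diff_eq minus_divide_right)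
    show ?thesis unfolding ** using *
      by (simp add: divide_simps) (simp add: algebra_simps)
  qed
  have "(\<Sum>i\<in>insert a I. hypoexp_coeff (insert a I) \<alpha> i * (\<alpha> i / (\<alpha> i - z))) =
      (\<Sum>i\<in>I. hypoexp_coeff I \<alpha> i * (\<alpha> i / (\<alpha> i - \<alpha> a)) * (\<alpha> a / (\<alpha> a - z))
        + hypoexp_coeff I \<alpha> i * (\<alpha> a / (\<alpha> a - \<alpha> i)) * (\<alpha> i / (\<alpha> i - z)))"
    using insert.hyps coeff_a coeff_i by (simp add: sum.distrib sum_distrib_right sum_divide_distrib)
  also have "\<dots> = (\<Sum>i\<in>I. hypoexp_coeff I \<alpha> i * (\<alpha> i / (\<alpha> i - z)) * (\<alpha> a / (\<alpha> a - z)))"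
    using neq nz summand by (intro sum.cong) auto
  also have "\<dots> = (\<Prod>j\<in>I. \<alpha> j / (\<alpha> j - z)) * (\<alpha> a / (\<alpha> a - z))"
    using IH[of z] insert.prems(3) by (simp add: sum_distrib_right sum_divide_distrib)
  finally show ?case
    using insert.hyps by (simp add: mult.commute)
qed

text \<open>Setting z = 0 in the partial fraction identity makes every fraction equal to 1.\<close>

lemma sum_hypoexp_coeff:
  assumes "finite I" "I \<noteq> {}" "inj_on \<alpha> I" "\<And>i. i \<in> I \<Longrightarrow> \<alpha> i \<noteq> 0"
  shows "(\<Sum>i\<in>I. hypoexp_coeff I \<alpha> i) = 1"
proof -
  have "0 \<notin> \<alpha> ` I" using assms(4) by force
  from partial_fractions_prod_linear[OF assms this] show ?thesis
    using assms(4) by (simp cong: sum.cong prod.cong)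
qed

text \<open>This sum is the form in which the coefficient of the new exponential comes out of the
  convolution integral, as the contribution of its lower limit.\<close>

lemma hypoexp_coeff_insert_new:
  assumes "finite I" "I \<noteq> {}" "a \<notin> I" "inj_on \<alpha> (insert a I)" "\<And>i. i \<in> I \<Longrightarrow> \<alpha> i \<noteq> 0"
  shows "hypoexp_coeff (insert a I) \<alpha> a = (\<Sum>i\<in>I. hypoexp_coeff I \<alpha> i * (\<alpha> i / (\<alpha> i - \<alpha> a)))"
proof -
  have notin: "\<alpha> a \<notin> \<alpha> ` I" and inj: "inj_on \<alpha> I"
    using assms(3,4) by (auto simp: inj_on_insert)
  show ?thesis
    using hypoexp_coeff_insert_self[OF assms(3,5) notin]
      partial_fractions_prod_linear[OF assms(1,2) inj assms(5) notin] by simp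
qed

subsection \<open>Linear independence of exponentials\<close>

text \<open>The points of the positive half-line where f does not vanish form an open set, and an
  open null set is empty. This turns almost everywhere identities of densities into pointwise
  ones.\<close>

lemma AE_lborel_continuous_imp_all:
  fixes f :: "real \<Rightarrow> real"
  assumes cont: "\<And>t. 0 < t \<Longrightarrow> isCont f t" and ae: "AE t in lborel. 0 < t \<longrightarrow> f t = 0" and "0 < t"
  shows "f t = 0"
proof -
  let ?S = "{0<..} \<inter> f -` (- {0})"
  have "open ?S"
    by (intro continuous_open_preimage) (auto simp: continuous_on_eq_continuous_at cont)
  moreover have "negligible ?S"
  proof -
    have "?S \<in> sets lborel" using \<open>open ?S\<close> by simp
    with ae have "?S \<in> null_sets lborel"
      by (subst AE_iff_null_sets) (auto elim!: eventually_mono)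
    then show ?thesis
      by (simp add: negligible_iff_null_sets null_sets_completionI)
  qed
  ultimately have "?S = {}"
    using open_not_negligible by blast
  with \<open>0 < t\<close> show ?thesis by auto
qed

text \<open>Multiplying by \<open>exp (\<alpha> a * t)\<close> makes the term of a constant, and
  differentiating removes it. What remains is a relation over I with coefficients
  \<open>B i * (\<alpha> a - \<alpha> i)\<close>, whose second factors are nonzero by
  distinctness.\<close>

lemma exponentials_independent:
  fixes \<alpha> B :: "'i \<Rightarrow> real"
  assumes "finite I" "inj_on \<alpha> I" "\<And>t. 0 < t \<Longrightarrow> (\<Sum>i\<in>I. B i * exp (- \<alpha> i * t)) = 0" "i \<in> I"
  shows "B i = 0"
  using assms
proof (induction I arbitrary: B i rule: finite_induct)
  case empty
  then show ?case by simp
next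
  case (insert a I)
  have zero: "B a + (\<Sum>i\<in>I. B i * exp ((\<alpha> a - \<alpha> i) * t)) = 0" if "0 < t" for t
  proof -
    have "(\<Sum>i\<in>insert a I. B i * exp (- \<alpha> i * t)) * exp (\<alpha> a * t) = 0"
      using insert.prems(2)[OF that] by simp
    also have "(\<Sum>i\<in>insert a I. B i * exp (- \<alpha> i * t)) * exp (\<alpha> a * t) =
        (\<Sum>i\<in>insert a I. B i * exp ((\<alpha> a - \<alpha> i) * t))"
      by (simp add: sum_distrib_right mult.assoc exp_add[symmetric] left_diff_distrib
          del: sum.insert)
    finally show ?thesis using insert.hyps by simp
  qed
  have "(\<Sum>i\<in>I. (B i * (\<alpha> a - \<alpha> i)) * exp (- \<alpha> i * t)) = 0" if "0 < t" for t
  proof -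
    let ?g = "\<lambda>t. B a + (\<Sum>i\<in>I. B i * exp ((\<alpha> a - \<alpha> i) * t))"
    have "(?g has_real_derivative (\<Sum>i\<in>I. B i * (exp ((\<alpha> a - \<alpha> i) * t) * (\<alpha> a - \<alpha> i)))) (at t)"
      by (auto intro!: derivative_eq_intros simp: mult_ac)
    moreover have "(?g has_real_derivative 0) (at t)"
      by (rule has_field_derivative_transform_within_open[where f = "\<lambda>_. 0" and S = "{0<..}"])
        (use that zero in auto)
    ultimately have "(\<Sum>i\<in>I. B i * (exp ((\<alpha> a - \<alpha> i) * t) * (\<alpha> a - \<alpha> i))) = 0"
      by (rule DERIV_unique)
    \<comment> \<open>Undoing the earlier multiplication restores the shape required by the
      induction hypothesis.\<close>
    then have "exp (- \<alpha> a * t) * (\<Sum>i\<in>I. B i * (exp ((\<alpha> a - \<alpha> i) * t) * (\<alpha> a - \<alpha> i))) = 0"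
      by simp
    moreover have "exp (- \<alpha> a * t) * exp ((\<alpha> a - \<alpha> i) * t) = exp (- \<alpha> i * t)" for i
      by (simp add: exp_add[symmetric] left_diff_distrib)
    then have "exp (- \<alpha> a * t) * (B i * (exp ((\<alpha> a - \<alpha> i) * t) * (\<alpha> a - \<alpha> i))) =
        (B i * (\<alpha> a - \<alpha> i)) * exp (- \<alpha> i * t)" for i
      by (metis mult.commute mult.left_commute)
    ultimately show ?thesis
      by (simp only: sum_distrib_left)
  qed
  then have "B i * (\<alpha> a - \<alpha> i) = 0" if "i \<in> I" for i
    using insert.IH[of "\<lambda>i. B i * (\<alpha> a - \<alpha> i)" i] insert.prems(1) that by (simp add: inj_on_insert)
  moreover have "\<alpha> a \<noteq> \<alpha> i" if "i \<in> I" for i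
    using insert.prems(1) insert.hyps that by (metis inj_onD insertI1 insertI2)
  ultimately have B0: "B i = 0" if "i \<in> I" for i
    using that by simp
  moreover have "B a = 0"
    using zero[of 1] B0 by simp
  ultimately show ?case
    using insert.prems(3) by auto
qed

subsection \<open>Powers of exponential variables\<close>

lemma weibull_density_measurable [measurable]: "weibull_density k l \<in> borel_measurable borel"
  unfolding weibull_density_def by measurable

lemma weibull_density_nonneg: "0 < k \<Longrightarrow> 0 < l \<Longrightarrow> 0 \<le> weibull_density k l t"
  by (simp add: weibull_density_def)

text \<open>The density has antiderivative -exp(-(t/l)^k), which tends to 0 at infinity. Taking x >
  0 keeps the integration away from the origin, where the power may fail to be
  differentiable.\<close>

lemma emeasure_weibull_gt:
  assumes "0 < k" "0 < l" "0 < x"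
  shows "emeasure (density lborel (\<lambda>t. ennreal (weibull_density k l t))) {x<..} = ennreal (exp (- ((x / l) powr k)))"
proof -
  let ?F = "\<lambda>t. - exp (- ((t / l) powr k))"
  have "emeasure (density lborel (\<lambda>t. ennreal (weibull_density k l t))) {x<..} =
      (\<integral>\<^sup>+t. ennreal (weibull_density k l t) * indicator {x<..} t \<partial>lborel)"
    by (simp add: emeasure_density)
  also have "\<dots> = (\<integral>\<^sup>+t. ennreal (weibull_density k l t) * indicator {x..} t \<partial>lborel)"
    using AE_lborel_singleton[of x]
    by (intro nn_integral_cong_AE) (auto elim!: eventually_mono simp: indicator_def)
  also have "\<dots> = ennreal (0 - ?F x)"
  proof (rule nn_integral_FTC_atLeast)
    fix t assume "x \<le> t"
    then have t: "0 < t" "0 < t / l" using assms by auto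
    have "((\<lambda>t. (t / l) powr k) has_real_derivative k * (t / l) powr (k - 1) * (1 / l)) (at t)"
      using t assms by (auto intro!: derivative_eq_intros)
    then show "(?F has_real_derivative weibull_density k l t) (at t)"
      unfolding weibull_density_def using t
      by (auto intro!: derivative_eq_intros)
  next
    show "(?F \<longlongrightarrow> 0) at_top"
      using assms(1,2) by real_asymp
  qed (use assms weibull_density_nonneg in auto)
  finally show ?thesis by simp
qed

text \<open>Positive tails suffice: \<open>{0<..}\<close> is an increasing union of them, and for x
  \<le> 0 the tail agrees with \<open>{0<..}\<close> up to a null set. So no tail needs to be
  computed where \<open>powr\<close> has a nonpositive base.\<close>

lemma measure_eqI_greaterThan_pos:
  fixes M N :: "real measure"
  assumes sets: "sets M = sets borel" "sets N = sets borel"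
    and pos: "AE x in M. 0 < x" "AE x in N. 0 < x"
    and fin: "finite_measure M"
    and eq: "\<And>x. 0 < x \<Longrightarrow> emeasure M {x<..} = emeasure N {x<..}"
  shows "M = N"
proof (rule measure_eqI_lessThan[OF sets])
  have union: "{0<..} = (\<Union>n. {1 / real (Suc n)<..})"
  proof (intro set_eqI iffI)
    fix x :: real assume "x \<in> {0<..}"
    then obtain n where "1 / real (Suc n) < x"
      by (metis greaterThan_iff nat_approx_posE)
    then show "x \<in> (\<Union>n. {1 / real (Suc n)<..})" by auto
  next
    fix x :: real assume "x \<in> (\<Union>n. {1 / real (Suc n)<..})"
    then obtain n where "1 / real (Suc n) < x" by auto
    moreover have "0 < 1 / real (Suc n)" by simp
    ultimately show "x \<in> {0<..}" unfolding greaterThan_iff by (rule less_trans[rotated])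
  qed
  have inc: "incseq (\<lambda>n. {1 / real (Suc n)<..})"
  proof (intro monoI)
    fix m n :: nat assume "m \<le> n"
    then have "1 / real (Suc n) \<le> 1 / real (Suc m)"
      by (intro divide_left_mono) auto
    then show "{1 / real (Suc m)<..} \<subseteq> {1 / real (Suc n)<..}" by auto
  qed
  have zero: "emeasure M {0<..} = emeasure N {0<..}"
    unfolding union using inc sets eq
    by (subst (1 2) SUP_emeasure_incseq[symmetric]) (auto intro!: SUP_cong)
  fix x :: real
  show "emeasure M {x<..} < \<infinity>"
    using finite_measure.emeasure_finite[OF fin] by (simp add: less_top)
  show "emeasure M {x<..} = emeasure N {x<..}"
  proof (cases "0 < x")
    case False
    have "emeasure M {x<..} = emeasure M {0<..}" "emeasure N {x<..} = emeasure N {0<..}"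
      using pos False sets by (auto intro!: emeasure_eq_AE elim!: eventually_mono)
    with zero show ?thesis by simp
  qed (use eq in auto)
qed

lemma (in prob_space) AE_exponential_pos:
  assumes "distributed M lborel X (exponential_density l)" "0 < l"
  shows "AE \<omega> in M. 0 < X \<omega>"
proof -
  have [measurable]: "X \<in> borel_measurable M"
    using distributed_measurable[OF assms(1)] by simp
  have "prob {\<omega> \<in> space M. 0 < X \<omega>} = 1"
    using exponential_distributedD_gt[OF assms(1) order_refl assms(2)] by simp
  then show ?thesis
    by (subst (asm) prob_Collect_eq_1) auto
qed

text \<open>Compare tails: P(X^c > x) = P(X > x^(1/c)) = exp(-a x^(1/c)), which is the Weibull tail
  because (x a^c)^(1/c) = a x^(1/c).\<close>

lemma (in prob_space) distributed_exponential_powr: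
  assumes X: "distributed M lborel X (exponential_density a)" and pos: "0 < a" "0 < c"
  shows "distributed M lborel (\<lambda>\<omega>. X \<omega> powr c) (weibull_density (1 / c) (1 / a powr c))"
proof -
  let ?W = "density lborel (\<lambda>t. ennreal (weibull_density (1 / c) (1 / a powr c) t))"
  have [measurable]: "X \<in> borel_measurable M"
    using distributed_measurable[OF X] by simp
  have ae: "AE \<omega> in M. 0 < X \<omega>"
    by (rule AE_exponential_pos[OF X pos(1)])
  have "distr M borel (\<lambda>\<omega>. X \<omega> powr c) = ?W"
  proof (rule measure_eqI_greaterThan_pos)
    show "AE x in distr M borel (\<lambda>\<omega>. X \<omega> powr c). 0 < x"
      using ae by (subst AE_distr_iff) (auto elim!: eventually_mono)
    show "AE x in ?W. 0 < x"
      by (subst AE_density) (auto simp: weibull_density_def)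
    show "finite_measure (distr M borel (\<lambda>\<omega>. X \<omega> powr c))"
      by (intro finite_measure_distr) simp
    fix x :: real assume x: "0 < x"
    have iff: "x < y powr c \<longleftrightarrow> x powr (1 / c) < y" if "0 < y" for y
    proof -
      have "x powr (1 / c) < (y powr c) powr (1 / c) \<longleftrightarrow> x < y powr c"
        using x pos(2) that powr_less_mono2[of "1 / c" x "y powr c"] powr_less_cancel2[of "1 / c" x "y powr c"]
        by auto
      then show ?thesis using that pos(2) by (simp add: powr_powr)
    qed
    have "emeasure (distr M borel (\<lambda>\<omega>. X \<omega> powr c)) {x<..} = emeasure M {\<omega> \<in> space M. x < X \<omega> powr c}"
      by (subst emeasure_distr) (auto intro!: arg_cong[where f = "emeasure M"])
    also have "\<dots> = emeasure M {\<omega> \<in> space M. x powr (1 / c) < X \<omega>}"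
      using ae by (intro emeasure_eq_AE) (auto elim!: eventually_mono simp: iff)
    also have "\<dots> = ennreal (exp (- (x powr (1 / c)) * a))"
      using exponential_distributedD_gt[OF X _ pos(1), of "x powr (1 / c)"]
      by (simp add: emeasure_eq_measure)
    also have "\<dots> = emeasure ?W {x<..}"
      using x pos by (subst emeasure_weibull_gt) (auto simp: powr_mult powr_powr)
    finally show "emeasure (distr M borel (\<lambda>\<omega>. X \<omega> powr c)) {x<..} = emeasure ?W {x<..}" .
  qed simp_all
  then show ?thesis
    by (auto simp: distributed_def cong: distr_cong)
qed

text \<open>Change of variables by x -> x^c; the last factor is the Jacobian of the inverse map. It
  does not involve a, so it can be pulled out of any mixture over different rates.\<close>

lemma weibull_density_eq_exponential_density:
  assumes "0 < a" "0 < c" "0 < t"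
  shows "weibull_density (1 / c) (1 / a powr c) t =
    exponential_density a (t powr (1 / c)) * (1 / c * t powr (1 / c - 1))"
proof -
  \<comment> \<open>The constants in the Weibull prefactor, with 1/l = a^c, collapse to the rate
    a.\<close>
  have "(a powr c) * (a powr c) powr (1 / c - 1) = a"
    using assms by (simp add: powr_powr powr_add[symmetric] right_diff_distrib)
  then show ?thesis
    using assms
    by (simp add: weibull_density_def exponential_density_def powr_mult powr_powr mult_ac)
qed

subsection \<open>The hypoexponential law\<close>

lemma hypoexp_density_measurable [measurable]: "hypoexp_density I \<alpha> \<in> borel_measurable borel"
  unfolding hypoexp_density_def by measurable

text \<open>Integrating termwise over [0,t], the upper limit yields the old exponentials and the
  lower limit the new one; the two insertion lemmas identify their coefficients. Nonnegativity is
  tracked because the coefficients have mixed signs and \<open>ennreal\<close> truncates.\<close>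

lemma exponential_convolution_hypoexp_density:
  assumes fin: "finite I" "I \<noteq> {}" and a: "a \<notin> I" and inj: "inj_on \<alpha> (insert a I)"
    and pos: "\<And>i. i \<in> insert a I \<Longrightarrow> 0 < \<alpha> i"
    and nonneg: "\<And>s. 0 \<le> hypoexp_density I \<alpha> s"
  shows "(\<integral>\<^sup>+s. ennreal (exponential_density (\<alpha> a) (t - s)) * ennreal (hypoexp_density I \<alpha> s) \<partial>lborel) =
      ennreal (hypoexp_density (insert a I) \<alpha> t)"
    and "0 \<le> hypoexp_density (insert a I) \<alpha> t"
proof -
  let ?h = "hypoexp_coeff I \<alpha>" and ?\<beta> = "\<alpha> a"
  have a_pos: "0 < ?\<beta>" using pos by simp
  have neq: "\<alpha> i \<noteq> ?\<beta>" if "i \<in> I" for i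
    using inj a that by (metis inj_onD insertI1 insertI2)
  let ?f = "\<lambda>s. exponential_density ?\<beta> (t - s) * hypoexp_density I \<alpha> s"
  \<comment> \<open>An antiderivative in s of the integrand on [0,t]: the product of the i-th
    exponential with the new one has exponent (\<open>?\<beta>\<close> - \<alpha>_i) s -
    \<open>?\<beta>\<close> t, whose slope is nonzero by distinctness.\<close>
  let ?F = "\<lambda>s. \<Sum>i\<in>I. ?h i * (\<alpha> i * ?\<beta> / (?\<beta> - \<alpha> i) * exp ((?\<beta> - \<alpha> i) * s - ?\<beta> * t))"
  have f_nonneg: "0 \<le> ?f s" for s
    using nonneg a_pos by (intro mult_nonneg_nonneg exponential_density_nonneg) auto
  \<comment> \<open>One factor vanishes for s < 0 and the other for s > t.\<close>
  have lhs: "(\<integral>\<^sup>+s. ennreal (exponential_density ?\<beta> (t - s)) * ennreal (hypoexp_density I \<alpha> s) \<partial>lborel) =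
      (\<integral>\<^sup>+s. ennreal (?f s) * indicator {0..t} s \<partial>lborel)"
    using nonneg a_pos
    by (intro nn_integral_cong)
      (auto simp: ennreal_mult exponential_density_nonneg indicator_def exponential_density_def hypoexp_density_def)
  have "(\<integral>\<^sup>+s. ennreal (?f s) * indicator {0..t} s \<partial>lborel) = ennreal (hypoexp_density (insert a I) \<alpha> t)
      \<and> 0 \<le> hypoexp_density (insert a I) \<alpha> t"
  proof (cases "0 \<le> t")
    case False
    then show ?thesis
      by (simp add: hypoexp_density_def exponential_density_def)
  next
    case True
    have deriv: "(?F has_real_derivative ?f s) (at s)" if "s \<in> {0..t}" for s
    proof -
      have "(?F has_real_derivative
          (\<Sum>i\<in>I. ?h i * (\<alpha> i * ?\<beta> / (?\<beta> - \<alpha> i) * (exp ((?\<beta> - \<alpha> i) * s - ?\<beta> * t) * (?\<beta> - \<alpha> i))))) (at s)"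
        by (intro DERIV_sum DERIV_cmult) (auto intro!: derivative_eq_intros)
      also have "(\<Sum>i\<in>I. ?h i * (\<alpha> i * ?\<beta> / (?\<beta> - \<alpha> i) * (exp ((?\<beta> - \<alpha> i) * s - ?\<beta> * t) * (?\<beta> - \<alpha> i)))) = ?f s"
        unfolding hypoexp_density_def sum_distrib_left
      proof (intro sum.cong refl)
        fix i assume "i \<in> I"
        have "exp ((?\<beta> - \<alpha> i) * s - ?\<beta> * t) = exp (- (t - s) * ?\<beta>) * exp (- s * \<alpha> i)"
          by (simp add: exp_add[symmetric] algebra_simps)
        then show "?h i * (\<alpha> i * ?\<beta> / (?\<beta> - \<alpha> i) * (exp ((?\<beta> - \<alpha> i) * s - ?\<beta> * t) * (?\<beta> - \<alpha> i))) =
            exponential_density ?\<beta> (t - s) * (?h i * exponential_density (\<alpha> i) s)"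
          using that neq[OF \<open>i \<in> I\<close>] by (simp add: exponential_density_def)
      qed
      finally show ?thesis .
    qed
    have "(\<integral>\<^sup>+s. ennreal (?f s) * indicator {0..t} s \<partial>lborel) = ennreal (?F t - ?F 0)"
      by (rule nn_integral_FTC_Icc) (use deriv f_nonneg True in auto)
    \<comment> \<open>Without this, equality after \<open>ennreal\<close> would not determine the
      sign of the difference.\<close>
    moreover have "?F 0 \<le> ?F t"
      using deriv f_nonneg True
      by (intro DERIV_nonneg_imp_nondecreasing[of 0 t ?F]) (auto 4 4)
    moreover have "?F t - ?F 0 = hypoexp_density (insert a I) \<alpha> t"
    proof -
      \<comment> \<open>The minus sign of the lower limit is absorbed by reversing the denominator,
        as in \<open>m\<close> below.\<close>
      have "?F t - ?F 0 = (\<Sum>i\<in>I. ?h i * (?\<beta> / (?\<beta> - \<alpha> i)) * (\<alpha> i * exp (- t * \<alpha> i))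
          + ?h i * (\<alpha> i / (\<alpha> i - ?\<beta>)) * (?\<beta> * exp (- t * ?\<beta>)))"
        unfolding sum_subtractf[symmetric]
      proof (intro sum.cong refl)
        fix i assume "i \<in> I"
        have e: "(?\<beta> - \<alpha> i) * t - ?\<beta> * t = - t * \<alpha> i" "(?\<beta> - \<alpha> i) * 0 - ?\<beta> * t = - t * ?\<beta>"
          by (simp_all add: algebra_simps)
        have m: "\<alpha> i / (\<alpha> i - ?\<beta>) = - (\<alpha> i / (?\<beta> - \<alpha> i))"
          by (metis minus_diff_eq minus_divide_right)
        show "?h i * (\<alpha> i * ?\<beta> / (?\<beta> - \<alpha> i) * exp ((?\<beta> - \<alpha> i) * t - ?\<beta> * t)) -
            ?h i * (\<alpha> i * ?\<beta> / (?\<beta> - \<alpha> i) * exp ((?\<beta> - \<alpha> i) * 0 - ?\<beta> * t)) =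
            ?h i * (?\<beta> / (?\<beta> - \<alpha> i)) * (\<alpha> i * exp (- t * \<alpha> i))
            + ?h i * (\<alpha> i / (\<alpha> i - ?\<beta>)) * (?\<beta> * exp (- t * ?\<beta>))"
          unfolding e m by (simp add: mult_ac)
      qed
      also have "\<dots> = (\<Sum>i\<in>I. hypoexp_coeff (insert a I) \<alpha> i * exponential_density (\<alpha> i) t)
          + hypoexp_coeff (insert a I) \<alpha> a * exponential_density ?\<beta> t"
      proof -
        have "hypoexp_coeff (insert a I) \<alpha> a = (\<Sum>i\<in>I. ?h i * (\<alpha> i / (\<alpha> i - ?\<beta>)))"
          using pos by (intro hypoexp_coeff_insert_new fin a inj) (metis insertI2 less_irrefl)
        moreover have "hypoexp_coeff (insert a I) \<alpha> i = ?h i * (?\<beta> / (?\<beta> - \<alpha> i))" if "i \<in> I" for i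
          using neq a_pos that by (intro hypoexp_coeff_insert_old fin a) auto
        ultimately show ?thesis
          using True by (simp add: sum.distrib sum_distrib_right exponential_density_def)
      qed
      finally show ?thesis
        using fin a by (simp add: hypoexp_density_def)
    qed
    ultimately show ?thesis by simp
  qed
  with lhs show "(\<integral>\<^sup>+s. ennreal (exponential_density ?\<beta> (t - s)) * ennreal (hypoexp_density I \<alpha> s) \<partial>lborel) =
      ennreal (hypoexp_density (insert a I) \<alpha> t)" "0 \<le> hypoexp_density (insert a I) \<alpha> t"
    by simp_all
qed

lemma prob_space_exponential_law: "0 < a \<Longrightarrow> prob_space (exponential_law a)"
  unfolding exponential_law_def by (rule prob_space_exponential_density)

lemma sets_exponential_law [measurable_cong, simp]: "sets (exponential_law a) = sets borel"
  by (simp add: exponential_law_def)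

lemma prob_space_hypoexponential_law:
  assumes "\<And>i. i \<in> I \<Longrightarrow> 0 < \<alpha> i"
  shows "prob_space (hypoexponential_law I \<alpha>)"
proof -
  interpret prob_space "\<Pi>\<^sub>M i\<in>I. exponential_law (\<alpha> i)"
    using assms by (intro prob_space_PiM prob_space_exponential_law)
  show ?thesis
    unfolding hypoexponential_law_def by (rule prob_space_distr) measurable
qed

text \<open>The product over \<open>insert a I\<close> is an image of the product of the a-th law
  with the product over I. Summing the I-coordinates first leaves an independent pair, and adding
  its components is convolution.\<close>

lemma hypoexponential_law_insert:
  assumes "finite I" "a \<notin> I" and pos: "\<And>i. i \<in> insert a I \<Longrightarrow> 0 < \<alpha> i"
  shows "hypoexponential_law (insert a I) \<alpha> = convolution (exponential_law (\<alpha> a)) (hypoexponential_law I \<alpha>)"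
proof -
  let ?P = "\<Pi>\<^sub>M i\<in>I. exponential_law (\<alpha> i)" and ?E = "exponential_law (\<alpha> a)"
  interpret H: prob_space "hypoexponential_law I \<alpha>"
    using pos by (intro prob_space_hypoexponential_law) auto
  have "hypoexponential_law (insert a I) \<alpha> =
      distr (distr (?E \<Otimes>\<^sub>M ?P) (\<Pi>\<^sub>M i\<in>insert a I. exponential_law (\<alpha> i)) (\<lambda>(x, X). X(a := x)))
        borel (\<lambda>x. \<Sum>i\<in>insert a I. x i)"
    unfolding hypoexponential_law_def
    using pos by (subst distr_pair_PiM_eq_PiM) (auto intro: prob_space_exponential_law)
  also have "\<dots> = distr (?E \<Otimes>\<^sub>M ?P) borel (\<lambda>(x, X). x + (\<Sum>i\<in>I. X i))"
  proof (subst distr_distr)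
    have "(\<Sum>i\<in>I. (X(a := x)) i) = (\<Sum>i\<in>I. X i)" for x :: real and X
      using assms(2) by (intro sum.cong) auto
    then show "distr (?E \<Otimes>\<^sub>M ?P) borel ((\<lambda>x. \<Sum>i\<in>insert a I. x i) \<circ> (\<lambda>(x, X). X(a := x))) =
        distr (?E \<Otimes>\<^sub>M ?P) borel (\<lambda>(x, X). x + (\<Sum>i\<in>I. X i))"
      using assms(1,2) by (auto intro!: distr_cong)
  qed measurable
  also have "\<dots> = distr (distr (?E \<Otimes>\<^sub>M ?P) (borel \<Otimes>\<^sub>M borel) (\<lambda>(x, X). (x, \<Sum>i\<in>I. X i)))
      borel (\<lambda>(x, y). x + y)"
    by (subst distr_distr) (auto intro!: distr_cong simp: comp_def case_prod_beta)
  also have "distr (?E \<Otimes>\<^sub>M ?P) (borel \<Otimes>\<^sub>M borel) (\<lambda>(x, X). (x, \<Sum>i\<in>I. X i)) =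
      distr ?E borel (\<lambda>x. x) \<Otimes>\<^sub>M distr ?P borel (\<lambda>X. \<Sum>i\<in>I. X i)"
    using H.sigma_finite_measure_axioms
    by (subst pair_measure_distr) (auto simp: hypoexponential_law_def)
  also have "distr ?E borel (\<lambda>x. x) = ?E"
    by (rule distr_id2) simp
  finally show ?thesis
    by (simp add: convolution_def hypoexponential_law_def)
qed

text \<open>Induction by one convolution at a time. Nonnegativity is part of the claim because the
  next convolution requires it and it cannot be read off a signed sum.\<close>

lemma hypoexponential_law_eq_density:
  assumes "finite I" "I \<noteq> {}" "inj_on \<alpha> I" "\<And>i. i \<in> I \<Longrightarrow> 0 < \<alpha> i"
  shows "hypoexponential_law I \<alpha> = density lborel (\<lambda>t. ennreal (hypoexp_density I \<alpha> t)) \<and>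
    (\<forall>t. 0 \<le> hypoexp_density I \<alpha> t)"
  using assms
proof (induction I rule: finite_ne_induct)
  case (singleton x)
  have "distr (\<Pi>\<^sub>M i\<in>{x}. exponential_law (\<alpha> i)) (exponential_law (\<alpha> x)) (\<lambda>\<omega>. \<omega> x) = exponential_law (\<alpha> x)"
    using singleton by (intro distr_PiM_component prob_space_exponential_law) auto
  then have "hypoexponential_law {x} \<alpha> = exponential_law (\<alpha> x)"
    by (simp add: hypoexponential_law_def cong: distr_cong)
  moreover have "hypoexp_density {x} \<alpha> t = exponential_density (\<alpha> x) t" for t
    by (simp add: hypoexp_density_def hypoexp_coeff_def)
  ultimately show ?case
    using singleton exponential_density_nonneg by (simp add: exponential_law_def)
next
  case (insert a I)
  then have IH: "hypoexponential_law I \<alpha> = density lborel (\<lambda>t. ennreal (hypoexp_density I \<alpha> t))"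
    and nonneg: "\<And>t. 0 \<le> hypoexp_density I \<alpha> t"
    by (auto simp: inj_on_insert)
  have step: "(\<integral>\<^sup>+s. ennreal (exponential_density (\<alpha> a) (t - s)) * ennreal (hypoexp_density I \<alpha> s) \<partial>lborel) =
      ennreal (hypoexp_density (insert a I) \<alpha> t)" "0 \<le> hypoexp_density (insert a I) \<alpha> t" for t
    using insert nonneg by (intro exponential_convolution_hypoexp_density; simp)+
  have "hypoexponential_law (insert a I) \<alpha> = convolution (exponential_law (\<alpha> a)) (hypoexponential_law I \<alpha>)"
    using insert by (intro hypoexponential_law_insert) auto
  also have "\<dots> = density lborel (\<lambda>t. ennreal (hypoexp_density (insert a I) \<alpha> t))"
    unfolding IH exponential_law_def
  proof (subst convolution_density)
    show "finite_measure (density lborel (\<lambda>t. ennreal (exponential_density (\<alpha> a) t)))"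
      using prob_space_exponential_density[of "\<alpha> a"] insert.prems by (simp add: prob_space.finite_measure)
    show "finite_measure (density lborel (\<lambda>t. ennreal (hypoexp_density I \<alpha> t)))"
      unfolding IH[symmetric] using insert.prems
      by (intro prob_space.finite_measure prob_space_hypoexponential_law) auto
    qed (simp_all add: step(1))
  finally show ?case using step(2) by simp
qed

subsection \<open>Densities of mixtures\<close>

lemma has_pdf_cong_AE:
  assumes "has_pdf D f" "g \<in> borel_measurable lborel" "AE t in lborel. f t = g t"
  shows "has_pdf D g"
proof -
  have "density lborel (\<lambda>t. ennreal (f t)) = density lborel (\<lambda>t. ennreal (g t))"
    using assms by (intro density_cong) (auto simp: has_pdf_def elim!: eventually_mono)
  moreover have "AE t in lborel. 0 \<le> g t"
    using assms by (auto simp: has_pdf_def elim: eventually_elim2)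
  ultimately show ?thesis
    using assms unfolding has_pdf_def by metis
qed

text \<open>Densities of a sigma-finite measure agree almost everywhere as \<open>ennreal\<close>
  functions; nonnegativity lifts this to the real values.\<close>

lemma has_pdf_unique:
  assumes "has_pdf D f" "has_pdf D g"
  shows "AE t in lborel. f t = g t"
proof -
  have [measurable]: "f \<in> borel_measurable lborel" "g \<in> borel_measurable lborel"
    and D: "density lborel (\<lambda>t. ennreal (f t)) = D" "density lborel (\<lambda>t. ennreal (g t)) = D"
    using assms unfolding has_pdf_def by simp_all
  interpret D: prob_space D
    using assms(1) unfolding has_pdf_def by blast
  have "AE t in lborel. ennreal (f t) = ennreal (g t)"
    using D D.sigma_finite_measure_axioms by (subst sigma_finite_density_unique[symmetric]) auto
  moreover have "AE t in lborel. 0 \<le> f t" "AE t in lborel. 0 \<le> g t"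
    using assms by (simp_all add: has_pdf_def)
  ultimately show ?thesis
    by eventually_elim simp
qed

lemma (in prob_space) distributed_imp_has_pdf:
  assumes "distributed M lborel X (\<lambda>t. ennreal (f t))" "f \<in> borel_measurable borel" "\<And>t. 0 \<le> f t"
  shows "has_pdf (distr M borel X) f"
proof -
  have "distr M borel X = distr M lborel X"
    by (intro distr_cong) auto
  moreover have "prob_space (distr M borel X)"
    using distributed_measurable[OF assms(1)] by (intro prob_space_distr) simp
  ultimately show ?thesis
    using assms by (simp add: has_pdf_def distributed_distr_eq_density)
qed

lemma has_pdf_imp_has_bochner_integral:
  assumes "has_pdf D f"
  shows "has_bochner_integral lborel f 1"
proof (rule has_bochner_integral_nn_integral)
  have "emeasure D (space D) = 1" and D: "D = density lborel (\<lambda>t. ennreal (f t))"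
    and [measurable]: "f \<in> borel_measurable lborel"
    using assms by (auto simp: has_pdf_def dest: prob_space.emeasure_space_1)
  then show "(\<integral>\<^sup>+t. ennreal (f t) \<partial>lborel) = ennreal 1"
    by (simp add: emeasure_density)
qed (use assms in \<open>auto simp: has_pdf_def\<close>)

text \<open>With signed weights the total mass comes from linearity of the Bochner integral;
  nonnegativity of the whole sum then transfers it to the nonnegative integral.\<close>

lemma has_pdf_mixture:
  assumes "finite I" "(\<Sum>i\<in>I. A i) = 1" "\<And>i. i \<in> I \<Longrightarrow> has_pdf (F i) (f i)"
    and "AE t in lborel. 0 \<le> (\<Sum>i\<in>I. A i * f i t)"
  shows "has_pdf (density lborel (\<lambda>t. ennreal (\<Sum>i\<in>I. A i * f i t))) (\<lambda>t. \<Sum>i\<in>I. A i * f i t)"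
proof -
  have meas [measurable]: "(\<lambda>t. \<Sum>i\<in>I. A i * f i t) \<in> borel_measurable lborel"
    using assms(3) by (intro borel_measurable_sum borel_measurable_times) (auto simp: has_pdf_def)
  have "has_bochner_integral lborel (\<lambda>t. \<Sum>i\<in>I. A i * f i t) (\<Sum>i\<in>I. A i * 1)"
    using assms(3) by (intro has_bochner_integral_sum has_bochner_integral_mult_right has_pdf_imp_has_bochner_integral)
  then have "(\<integral>\<^sup>+t. ennreal (\<Sum>i\<in>I. A i * f i t) \<partial>lborel) = 1"
    using assms(2,4) by (subst nn_integral_eq_integral) (auto simp: has_bochner_integral_iff)
  then show ?thesis
    using meas assms(4) by (auto simp: has_pdf_def emeasure_density intro!: prob_spaceI)
qed

text \<open>The difference of the two mixtures is continuous on the positive half-line, so it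
  vanishes there everywhere, and linear independence applies with coefficients
  \<open>(A i - B i) * \<alpha> i\<close>.\<close>

lemma exponential_mixture_weights_unique:
  fixes A B :: "'i \<Rightarrow> real"
  assumes "finite I" "inj_on \<alpha> I" and nz: "\<And>i. i \<in> I \<Longrightarrow> \<alpha> i \<noteq> 0" and "i \<in> I"
    and ae: "AE t in lborel. (\<Sum>i\<in>I. A i * exponential_density (\<alpha> i) t) =
      (\<Sum>i\<in>I. B i * exponential_density (\<alpha> i) t)"
  shows "A i = B i"
proof -
  let ?g = "\<lambda>t. \<Sum>i\<in>I. ((A i - B i) * \<alpha> i) * exp (- \<alpha> i * t)"
  have g: "?g t = (\<Sum>i\<in>I. A i * exponential_density (\<alpha> i) t) - (\<Sum>i\<in>I. B i * exponential_density (\<alpha> i) t)"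
    if "0 < t" for t
    using that by (simp add: exponential_density_def sum_subtractf[symmetric] algebra_simps)
  have "AE t in lborel. 0 < t \<longrightarrow> ?g t = 0"
    using ae by eventually_elim (use g in auto)
  then have "?g t = 0" if "0 < t" for t
    using that by (intro AE_lborel_continuous_imp_all[of ?g]) (auto intro!: continuous_intros)
  then have "(A i - B i) * \<alpha> i = 0"
    using assms(1,2,4) exponentials_independent[of I \<alpha> "\<lambda>i. (A i - B i) * \<alpha> i" i] by blast
  with nz[OF \<open>i \<in> I\<close>] show ?thesis by simp
qed

section \<open>Weibull marginals, existence of the mixed law, and its density\<close>

theorem mainTheorem8:
  fixes n :: nat and \<alpha> lam :: "nat \<Rightarrow> real" and c k :: real
    and M :: "'a measure" and X Y :: "nat \<Rightarrow> 'a \<Rightarrow> real"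
  assumes n: "2 \<le> n"
    and \<alpha>_pos: "\<And>i. i \<in> {1..n} \<Longrightarrow> 0 < \<alpha> i"
    and \<alpha>_distinct: "inj_on \<alpha> {1..n}"
    and c_pos: "0 < c"
    and M: "prob_space M"
    and indep: "prob_space.indep_vars M (\<lambda>_. borel) X {1..n}"
    and X_exp: "\<And>i. i \<in> {1..n} \<Longrightarrow> distributed M lborel (X i) (exponential_density (\<alpha> i))"
    and k: "k = 1 / c"
    and lam: "\<And>i. i \<in> {1..n} \<Longrightarrow> lam i = 1 / \<alpha> i powr c"
    and Y: "\<And>i \<omega>. i \<in> {1..n} \<Longrightarrow> Y i \<omega> = X i \<omega> powr c"
  defines "PW \<equiv> \<lambda>i. \<Prod>j\<in>{1..n} - {i}. (1 - (lam j / lam i) powr k)"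
    and "MHW \<equiv> mixed_TG {1..n} (\<lambda>i. distr M borel (X i)) (hypoexponential_law {1..n} \<alpha>)
                  {0<..} (\<lambda>x. x powr c)"
  shows "(\<forall>i\<in>{1..n}. distributed M lborel (Y i) (weibull_density k (lam i))) \<and>
         (\<exists>D. MHW D) \<and>
         (\<forall>D. MHW D \<longrightarrow>
            has_pdf D (\<lambda>t. \<Sum>i\<in>{1..n}. 1 / PW i * weibull_density k (lam i) t))"
proof -
  interpret prob_space M by (rule M)
  let ?I = "{1..n}" and ?e = "\<lambda>i. exponential_density (\<alpha> i)" and ?w = "\<lambda>i. weibull_density k (lam i)"
  let ?F = "\<lambda>i. distr M borel (X i)" and ?g = "\<lambda>x::real. x powr c"
  let ?mix = "\<lambda>t. \<Sum>i\<in>?I. 1 / PW i * ?w i t"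
  have I: "finite ?I" "?I \<noteq> {}" using n by auto
  have \<alpha>_nz: "\<alpha> i \<noteq> 0" if "i \<in> ?I" for i
    using \<alpha>_pos[OF that] by simp
  have X_meas: "X i \<in> borel_measurable M" if "i \<in> ?I" for i
    using distributed_measurable[OF X_exp[OF that]] by simp
  have Y_weibull: "distributed M lborel (Y i) (?w i)" if "i \<in> ?I" for i
  proof -
    have "Y i = (\<lambda>\<omega>. X i \<omega> powr c)" using Y[OF that] by auto
    then show ?thesis
      using distributed_exponential_powr[OF X_exp \<alpha>_pos c_pos] lam k that by simp
  qed
  have PW: "1 / PW i = hypoexp_coeff ?I \<alpha> i" if "i \<in> ?I" for i
  proof -
    have "(lam j / lam i) powr k = \<alpha> i / \<alpha> j" if "j \<in> ?I" for j
    proof -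
      have "lam j / lam i = (\<alpha> i / \<alpha> j) powr c"
        using lam \<open>i \<in> ?I\<close> that \<alpha>_pos by (simp add: powr_divide less_imp_le)
      then show ?thesis
        using k c_pos \<alpha>_pos[OF that] \<alpha>_pos[OF \<open>i \<in> ?I\<close>] by (simp add: powr_powr)
    qed
    then show ?thesis
      by (simp add: PW_def hypoexp_coeff_def)
  qed
  have pdf_X: "has_pdf (?F i) (?e i)" if "i \<in> ?I" for i
    using X_exp[OF that] \<alpha>_pos[OF that]
    by (intro distributed_imp_has_pdf) (auto simp: exponential_density_nonneg)
  have pdf_Y: "has_pdf (distr (?F i) borel ?g) (?w i)" if "i \<in> ?I" for i
  proof -
    have "distr (?F i) borel ?g = distr M borel (Y i)"
      using X_meas[OF that] Y[OF that] by (subst distr_distr) (auto intro!: distr_cong)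
    moreover have "has_pdf (distr M borel (Y i)) (?w i)"
      using Y_weibull[OF that] k c_pos lam[OF that] \<alpha>_pos[OF that]
      by (intro distributed_imp_has_pdf) (auto intro!: weibull_density_nonneg)
    ultimately show ?thesis by simp
  qed
  have sum_PW: "(\<Sum>i\<in>?I. 1 / PW i) = 1"
    using sum_hypoexp_coeff[OF I \<alpha>_distinct \<alpha>_nz] PW by simp
  have hypo: "hypoexp_density ?I \<alpha> t = (\<Sum>i\<in>?I. 1 / PW i * ?e i t)" for t
    by (simp add: hypoexp_density_def PW del: One_nat_def)
  have T_density: "hypoexponential_law ?I \<alpha> = density lborel (\<lambda>t. ennreal (hypoexp_density ?I \<alpha> t))"
    and T_nonneg: "\<And>t. 0 \<le> hypoexp_density ?I \<alpha> t"
    using hypoexponential_law_eq_density[OF I \<alpha>_distinct \<alpha>_pos] by auto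
  have pdf_T: "has_pdf (hypoexponential_law ?I \<alpha>) (\<lambda>t. \<Sum>i\<in>?I. 1 / PW i * ?e i t)"
    unfolding hypo[symmetric]
    using T_density T_nonneg prob_space_hypoexponential_law[of ?I \<alpha>] \<alpha>_pos by (simp add: has_pdf_def)
  have g: "?g \<in> borel_measurable borel" "inj_on ?g {0<..}" "\<forall>i\<in>?I. AE x in ?F i. x \<in> {0<..}"
  proof -
    show "inj_on ?g {0<..}"
      using c_pos by (intro inj_onI) (metis greaterThan_iff less_irrefl linorder_less_linear powr_less_mono2 less_imp_le)
    show "\<forall>i\<in>?I. AE x in ?F i. x \<in> {0<..}"
      using X_meas AE_exponential_pos[OF X_exp \<alpha>_pos] by (auto simp: AE_distr_iff)
  qed simp

  \<comment> \<open>Existence, with weights \<open>1 / PW i\<close>. These may be negative, so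
    nonnegativity of the mixture is deduced from the hypoexponential density rather than
    termwise.\<close>
  have "MHW (density lborel (\<lambda>t. ennreal (?mix t)))"
  proof -
    have "0 \<le> ?mix t" for t
    proof (cases "0 < t")
      case True
      have "?mix t = hypoexp_density ?I \<alpha> (t powr k) * (k * t powr (k - 1))"
        unfolding hypo sum_distrib_right
        using weibull_density_eq_exponential_density[OF \<alpha>_pos c_pos True] lam k
        by (intro sum.cong) (auto simp: mult_ac)
      then show ?thesis
        using T_nonneg k c_pos by simp
    qed (simp add: weibull_density_def)
    then have mix: "has_pdf (density lborel (\<lambda>t. ennreal (?mix t))) ?mix"
      using pdf_Y sum_PW I by (intro has_pdf_mixture) auto
    then show ?thesis
      unfolding MHW_def mixed_TG_def
      by (intro conjI exI[of _ "\<lambda>i. 1 / PW i"] exI[of _ ?e] exI[of _ ?w] ballI g pdf_X pdf_Y pdf_T sum_PW mix)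
  qed
  \<comment> \<open>\<open>mixed_TG\<close> allows any representing weights and densities. The
    component densities are fixed almost everywhere by their laws, and the weights are then forced
    by the density of the hypoexponential law.\<close>
  moreover have "has_pdf D ?mix" if "MHW D" for D
  proof -
    from that obtain A f h where sum_A: "(\<Sum>i\<in>?I. A i) = 1"
      and f: "\<And>i. i \<in> ?I \<Longrightarrow> has_pdf (?F i) (f i)"
      and h: "\<And>i. i \<in> ?I \<Longrightarrow> has_pdf (distr (?F i) borel ?g) (h i)"
      and T: "has_pdf (hypoexponential_law ?I \<alpha>) (\<lambda>t. \<Sum>i\<in>?I. A i * f i t)"
      and D: "has_pdf D (\<lambda>t. \<Sum>i\<in>?I. A i * h i t)"
      unfolding MHW_def mixed_TG_def by blast
    \<comment> \<open>Finiteness of the index set merges the exceptional null sets of all components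
      into one.\<close>
    have "AE t in lborel. \<forall>i\<in>?I. f i t = ?e i t"
      using has_pdf_unique[OF f pdf_X] I by (intro AE_finite_allI) auto
    moreover have "AE t in lborel. (\<Sum>i\<in>?I. A i * f i t) = (\<Sum>i\<in>?I. 1 / PW i * ?e i t)"
      by (rule has_pdf_unique[OF T pdf_T])
    ultimately have weights: "AE t in lborel. (\<Sum>i\<in>?I. A i * ?e i t) = (\<Sum>i\<in>?I. 1 / PW i * ?e i t)"
      by eventually_elim simp
    have A: "A i = 1 / PW i" if "i \<in> ?I" for i
      by (rule exponential_mixture_weights_unique[OF I(1) \<alpha>_distinct \<alpha>_nz that weights])
    have "AE t in lborel. \<forall>i\<in>?I. h i t = ?w i t"
      using has_pdf_unique[OF h pdf_Y] I by (intro AE_finite_allI) auto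
    then have "AE t in lborel. (\<Sum>i\<in>?I. A i * h i t) = ?mix t"
      by eventually_elim (use A in \<open>auto intro!: sum.cong\<close>)
    then show ?thesis
      by (intro has_pdf_cong_AE[OF D]) auto
  qed
  ultimately show ?thesis
    using Y_weibull by blast
qed

end
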